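(* Let $I\subseteq\mathbb{R}$ be an interval and let $\circ$ be a (not symmetric) strictly internal, monotone, continuous $2$-variable mean on $I$. Then its symmetrization $K^{(sym)}$ is symmetric: $K^{(sym)}(a,b)=K^{(sym)}(b,a)$ for all $a,b\in I$.
   Context: A $2$-variable mean on $I$ is a function $\circ: I^2\to I$ with $\min\{a,b\}\le a\circ b\le\max\{a,b\}$; it is strictly internal if $\min\{a,b\}<a\circ b<\max\{a,b\}$ whenever $a\ne b$, monotone if $a\le a'$, $b\le b'$ imply $a\circ b\le a'\circ b'$, and continuous if it is continuous as a function of two variables. For $a,b\in I$ define $a_0=a$, $b_0=b$, $a_{k+1}=\min\{a_k\circ b_k,\ b_k\circ a_k\}$, $b_{k+1}=\max\{a_k\circ b_k,\ b_k\circ a_k\}$. The sequences $(a_k)$ and $(b_k)$ converge to a common limit, denoted $K^{(sym)}(a,b)$. *)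

theory Defs
  imports "HOL-Analysis.Analysis"
begin

text \<open>
  A 2-variable mean on \<open>I\<close> is represented by a curried function on all reals; every
  property below constrains it only on \<open>I\<close>.
\<close>

definition mean_on :: "real set \<Rightarrow> (real \<Rightarrow> real \<Rightarrow> real) \<Rightarrow> bool" where
  "mean_on I m \<longleftrightarrow>
     (\<forall>a\<in>I. \<forall>b\<in>I. m a b \<in> I \<and> min a b \<le> m a b \<and> m a b \<le> max a b)"

definition strictly_internal_on :: "real set \<Rightarrow> (real \<Rightarrow> real \<Rightarrow> real) \<Rightarrow> bool" where
  "strictly_internal_on I m \<longleftrightarrow>
     (\<forall>a\<in>I. \<forall>b\<in>I. a \<noteq> b \<longrightarrow> min a b < m a b \<and> m a b < max a b)"

definition monotone_mean_on :: "real set \<Rightarrow> (real \<Rightarrow> real \<Rightarrow> real) \<Rightarrow> bool" where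
  "monotone_mean_on I m \<longleftrightarrow>
     (\<forall>a\<in>I. \<forall>a'\<in>I. \<forall>b\<in>I. \<forall>b'\<in>I. a \<le> a' \<longrightarrow> b \<le> b' \<longrightarrow> m a b \<le> m a' b')"

definition continuous_mean_on :: "real set \<Rightarrow> (real \<Rightarrow> real \<Rightarrow> real) \<Rightarrow> bool" where
  "continuous_mean_on I m \<longleftrightarrow> continuous_on (I \<times> I) (\<lambda>(x, y). m x y)"

text \<open>The sequences \<open>a\<^sub>k\<close> and \<open>b\<^sub>k\<close> started at \<open>a\<^sub>0 = a\<close>, \<open>b\<^sub>0 = b\<close>.\<close>

fun sym_lower :: "(real \<Rightarrow> real \<Rightarrow> real) \<Rightarrow> real \<Rightarrow> real \<Rightarrow> nat \<Rightarrow> real"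
  and sym_upper :: "(real \<Rightarrow> real \<Rightarrow> real) \<Rightarrow> real \<Rightarrow> real \<Rightarrow> nat \<Rightarrow> real"
where
  "sym_lower m a b 0 = a"
| "sym_lower m a b (Suc k) =
     min (m (sym_lower m a b k) (sym_upper m a b k)) (m (sym_upper m a b k) (sym_lower m a b k))"
| "sym_upper m a b 0 = b"
| "sym_upper m a b (Suc k) =
     max (m (sym_lower m a b k) (sym_upper m a b k)) (m (sym_upper m a b k) (sym_lower m a b k))"

text \<open>
  The common limit of the two sequences. It exists and is unique for the means considered here,
  see \<open>symmetrization_limits\<close> below.
\<close>

definition symmetrization :: "(real \<Rightarrow> real \<Rightarrow> real) \<Rightarrow> real \<Rightarrow> real \<Rightarrow> real" where
  "symmetrization m a b =
     (THE L. sym_lower m a b \<longlonglongrightarrow> L \<and> sym_upper m a b \<longlonglongrightarrow> L)"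

lemma sym_common_limit:
  assumes I: "is_interval I" and mean: "mean_on I m" and strict: "strictly_internal_on I m"
    and cont: "continuous_mean_on I m" and a: "a \<in> I" and b: "b \<in> I"
  shows "\<exists>L\<in>I. sym_lower m a b \<longlonglongrightarrow> L \<and> sym_upper m a b \<longlonglongrightarrow> L"
proof -
  define x where "x = (\<lambda>k. sym_lower m a b (Suc k))"
  define y where "y = (\<lambda>k. sym_upper m a b (Suc k))"
  have in_I: "sym_lower m a b k \<in> I \<and> sym_upper m a b k \<in> I" for k
  proof (induction k)
    case (Suc k)
    then have "m (sym_lower m a b k) (sym_upper m a b k) \<in> I"
      and "m (sym_upper m a b k) (sym_lower m a b k) \<in> I"
      using mean unfolding mean_on_def by blast+
    then show ?case by (simp add: min_def max_def)
  qed (use a b in simp)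
  have xI: "x k \<in> I" and yI: "y k \<in> I" for k
    using in_I by (simp_all only: x_def y_def)
  have xS: "x (Suc k) = min (m (x k) (y k)) (m (y k) (x k))"
    and yS: "y (Suc k) = max (m (x k) (y k)) (m (y k) (x k))" for k
    unfolding x_def y_def by (simp_all only: sym_lower.simps sym_upper.simps)
  have xy: "x k \<le> y k" for k
    unfolding x_def y_def by simp
  have mb: "min u v \<le> m u v" "m u v \<le> max u v" if "u \<in> I" "v \<in> I" for u v
    using mean that by (auto simp: mean_on_def)
  have step: "x k \<le> x (Suc k)" "y (Suc k) \<le> y k" for k
    using mb[OF xI[of k] yI[of k]] mb[OF yI[of k] xI[of k]] xy[of k]
    unfolding xS yS by auto
  have inc: "incseq x" and dec: "decseq y"
    using step by (auto intro: incseq_SucI decseq_SucI)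
  have xy0: "x k \<le> y 0" "x 0 \<le> y k" for k
    using xy[of k] decseqD[OF dec, of 0 k] incseqD[OF inc, of 0 k] by auto
  obtain A where A: "x \<longlonglongrightarrow> A" "\<And>k. x k \<le> A"
    using incseq_convergent[OF inc] xy0 by metis
  obtain B where B: "y \<longlonglongrightarrow> B" "\<And>k. B \<le> y k"
    using decseq_convergent[OF dec] xy0 by metis
  have AB: "A \<le> B"
    using LIMSEQ_le[OF A(1) B(1)] xy by auto
  have "x 0 \<le> A" "A \<le> y 0" "x 0 \<le> B" "B \<le> y 0"
    using A(2)[of 0] B(2)[of 0] AB by linarith+
  then have AI: "A \<in> I" and BI: "B \<in> I"
    using I xI[of 0] yI[of 0] unfolding is_interval_1 by blast+
  have lim: "(\<lambda>k. m (u k) (v k)) \<longlonglongrightarrow> m U V"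
    if "u \<longlonglongrightarrow> U" "v \<longlonglongrightarrow> V" "U \<in> I" "V \<in> I" "\<And>k. u k \<in> I" "\<And>k. v k \<in> I" for u v U V
    using continuous_on_tendsto_compose[OF cont[unfolded continuous_mean_on_def],
        of "\<lambda>k. (u k, v k)" "(U, V)" sequentially] that
    by (auto intro: tendsto_Pair)
  have "(\<lambda>k. x (Suc k)) \<longlonglongrightarrow> min (m A B) (m B A)"
    unfolding xS by (intro tendsto_min lim A(1) B(1) AI BI xI yI)
  then have "A = min (m A B) (m B A)"
    using LIMSEQ_unique LIMSEQ_Suc[OF A(1)] by blast
  then have "A = B"
    using strict[unfolded strictly_internal_on_def, rule_format, OF AI BI]
      strict[unfolded strictly_internal_on_def, rule_format, OF BI AI] AB
    by (cases "A = B") auto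
  moreover have "sym_lower m a b \<longlonglongrightarrow> A"
    by (rule LIMSEQ_imp_Suc) (use A(1) in \<open>simp only: x_def\<close>)
  moreover have "sym_upper m a b \<longlonglongrightarrow> B"
    by (rule LIMSEQ_imp_Suc) (use B(1) in \<open>simp only: y_def\<close>)
  ultimately show ?thesis using AI by blast
qed

lemma symmetrization_limits:
  assumes "is_interval I" "mean_on I m" "strictly_internal_on I m" "continuous_mean_on I m"
    and "a \<in> I" "b \<in> I"
  shows "sym_lower m a b \<longlonglongrightarrow> symmetrization m a b"
    and "sym_upper m a b \<longlonglongrightarrow> symmetrization m a b"
    and "symmetrization m a b \<in> I"
proof -
  obtain L where L: "L \<in> I" "sym_lower m a b \<longlonglongrightarrow> L" "sym_upper m a b \<longlonglongrightarrow> L"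
    using sym_common_limit[OF assms] by blast
  then have "symmetrization m a b = L"
    unfolding symmetrization_def by (blast intro: the_equality LIMSEQ_unique)
  with L show "sym_lower m a b \<longlonglongrightarrow> symmetrization m a b"
    and "sym_upper m a b \<longlonglongrightarrow> symmetrization m a b"
    and "symmetrization m a b \<in> I" by simp_all
qed

end

theory Submission
  imports Defs
begin

text \<open>
  The recursion step sends a pair \<open>(u, v)\<close> to the minimum and the maximum of the two values
  \<open>m u v\<close> and \<open>m v u\<close>, and this set of two values does not see the order of \<open>u\<close> and \<open>v\<close>. So the
  sequences started at \<open>(a, b)\<close> and at \<open>(b, a)\<close> coincide from index 1 on, and therefore have the
  same limits.
\<close>

lemma sym_sequences_swap_Suc:
  "sym_lower m a b (Suc k) = sym_lower m b a (Suc k) \<and>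
   sym_upper m a b (Suc k) = sym_upper m b a (Suc k)"
proof (induction k)
  case 0
  show ?case by (simp add: min.commute max.commute)
next
  case (Suc k)
  then show ?case
    by (simp only: sym_lower.simps(2)[of m _ _ "Suc k"] sym_upper.simps(2)[of m _ _ "Suc k"])
qed

lemma sym_lower_tendsto_swap:
  "sym_lower m a b \<longlonglongrightarrow> L \<longleftrightarrow> sym_lower m b a \<longlonglongrightarrow> L"
  using filterlim_sequentially_Suc[of "sym_lower m a b" "nhds L"]
    filterlim_sequentially_Suc[of "sym_lower m b a" "nhds L"]
  by (simp only: sym_sequences_swap_Suc[of m a b])

theorem proposition5p1:
  fixes I :: "real set" and m :: "real \<Rightarrow> real \<Rightarrow> real"
  assumes "is_interval I"
    and "mean_on I m"
    and "strictly_internal_on I m"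
    and "monotone_mean_on I m"
    and "continuous_mean_on I m"
  shows "\<forall>a\<in>I. \<forall>b\<in>I. symmetrization m a b = symmetrization m b a"
proof (intro ballI)
  fix a b
  assume ab: "a \<in> I" "b \<in> I"
  note lims = symmetrization_limits[OF assms(1-3,5)]
  have "sym_lower m a b \<longlonglongrightarrow> symmetrization m b a"
    using lims(1)[OF ab(2,1)] by (simp only: sym_lower_tendsto_swap[of m a b])
  then show "symmetrization m a b = symmetrization m b a"
    using lims(1)[OF ab] by (rule LIMSEQ_unique[symmetric])
qed

end
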